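(* For a positive integer $y$ let $G(y)$ be the number of distinct primes in the set $\{\lfloor y/n\rfloor : 1\le n\le y\}$. If $x$ is any prime not equal to $3$, then $G(x)=G(x-1)+1$.
   Context: For a positive integer $y$, $\mathcal{G}(y)=\{\lfloor y/n\rfloor : n\in\mathbb{Z},\ 1\le n\le y,\ \lfloor y/n\rfloor \text{ is prime}\}$, regarded as a set (repeated values counted once), and $G(y)=|\mathcal{G}(y)|$. Here $\lfloor\cdot\rfloor$ is the floor function. *)

theory Defs
  imports Complex_Main "HOL-Computational_Algebra.Primes"
begin

text \<open>Division on \<^typ>\<open>nat\<close> is the floor of the quotient; \<open>quotient_primes_floor\<close> below restates
  the definition with the real floor function.\<close>

definition quotient_primes :: "nat \<Rightarrow> nat set" where
  "quotient_primes y = {y div n | n. 1 \<le> n \<and> n \<le> y \<and> prime (y div n)}"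

definition G :: "nat \<Rightarrow> nat" where
  "G y = card (quotient_primes y)"

lemma quotient_primes_floor:
  "int ` quotient_primes y =
     {\<lfloor>real y / real n\<rfloor> | n :: nat. 1 \<le> n \<and> n \<le> y \<and> prime \<lfloor>real y / real n\<rfloor>}"
  unfolding quotient_primes_def floor_divide_of_nat_eq by auto

lemma finite_quotient_primes: "finite (quotient_primes y)"
  unfolding quotient_primes_def by (rule finite_subset[of _ "(\<lambda>n. y div n) ` {1..y}"]) auto

end

theory Submission
  imports Defs
begin

text \<open>
  For \<open>n\<close> not dividing \<open>x\<close> we have \<open>x div n = (x - 1) div n\<close>, so for prime \<open>x\<close> the two quotient
  sequences can differ only at \<open>n = 1\<close> and \<open>n = x\<close>. The latter contributes the non-prime \<open>1\<close>,
  and the former contributes \<open>x\<close> against \<open>x - 1\<close>, which is not prime since \<open>x \<noteq> 3\<close>.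
\<close>

text \<open>Parity: if \<open>x - 1\<close> were prime too, \<open>x\<close> would be odd, and so
  would \<open>x - 1\<close>, which exceeds 2 because \<open>x \<noteq> 3\<close>.\<close>

lemma not_prime_pred_prime:
  fixes x :: nat
  assumes "prime x" "x \<noteq> 3"
  shows "\<not> prime (x - 1)"
proof
  assume p: "prime (x - 1)"
  then have "2 < x"
    using prime_ge_2_nat[of "x - 1"] by simp
  with assms have "odd x" "2 < x - 1"
    using prime_odd_nat by auto
  with prime_odd_nat[OF p] show False
    by simp
qed

lemma quotient_primes_prime:
  fixes x :: nat
  assumes "prime x" "x \<noteq> 3"
  shows "quotient_primes x = insert x (quotient_primes (x - 1))"
proof -
  have div_pred: "x div n = (x - 1) div n" if "n \<noteq> 1" "n \<noteq> x" for n
  proof -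
    have "\<not> n dvd x"
      using assms(1) that by (auto simp: prime_nat_iff)
    moreover have "x = Suc (x - 1)"
      using prime_gt_0_nat[OF assms(1)] by simp
    \<comment> \<open>The quotient by \<open>n\<close> jumps only on reaching a multiple of
      \<open>n\<close>.\<close>
    ultimately show ?thesis
      using div_Suc[of "x - 1" n] by (simp add: dvd_eq_mod_eq_0)
  qed
  have pos: "0 < x"
    using assms(1) by (rule prime_gt_0_nat)
  show ?thesis
  proof (intro equalityI subsetI)
    fix q assume "q \<in> quotient_primes x"
    then obtain n where n: "1 \<le> n" "n \<le> x" "q = x div n" "prime q"
      by (auto simp: quotient_primes_def)
    show "q \<in> insert x (quotient_primes (x - 1))"
    proof (cases "n = 1")
      case False
      \<comment> \<open>Otherwise \<open>q = 1\<close>. Hence \<open>n \<le> x - 1\<close>, the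
        range needed for \<open>x - 1\<close>.\<close>
      have "n \<noteq> x"
        using n pos by auto
      with False n div_pred[of n] show ?thesis
        by (auto simp: quotient_primes_def intro!: exI[of _ n])
    qed (use n in simp)
  next
    fix q assume "q \<in> insert x (quotient_primes (x - 1))"
    then consider "q = x"
      | n where "1 \<le> n" "n \<le> x - 1" "q = (x - 1) div n" "prime q"
      by (auto simp: quotient_primes_def)
    then show "q \<in> quotient_primes x"
    proof cases
      case 1
      with assms(1) pos show ?thesis
        by (auto simp: quotient_primes_def intro!: exI[of _ 1])
    next
      case (2 n)
      \<comment> \<open>Otherwise \<open>q = x - 1\<close> would be prime.\<close>
      then have "n \<noteq> 1"
        using not_prime_pred_prime[OF assms] by auto
      with 2 pos div_pred[of n] show ?thesis
        by (auto simp: quotient_primes_def intro!: exI[of _ n])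
    qed
  qed
qed

theorem theorem2:
  fixes x :: nat
  assumes "prime x" and "x \<noteq> 3"
  shows "G x = G (x - 1) + 1"
proof -
  \<comment> \<open>This bound makes the inserted \<open>x\<close> a new element.\<close>
  have "q \<le> x - 1" if "q \<in> quotient_primes (x - 1)" for q
    using that by (auto simp: quotient_primes_def)
  then have "x \<notin> quotient_primes (x - 1)"
    using prime_gt_0_nat[OF assms(1)] by fastforce
  then show ?thesis
    by (simp add: G_def quotient_primes_prime[OF assms] finite_quotient_primes)
qed

end
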